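(* The measure $\mu$ on $\Sigma$ whose density in the inverse slope coordinate $u$ is $$\frac{du}{1+\sqrt2-u}$$ is invariant under the octagon Farey map $F$ (restricted to its invariant set $\Sigma$), i.e. $\mu(F^{-1}(D)\cap\Sigma)=\mu(D)$ for every measurable $D\subset\Sigma$.
   Context: Matrices: $$\gamma=\begin{pmatrix}-1&2(1+\sqrt2)\\0&1\end{pmatrix},\quad \nu_0=\begin{pmatrix}1&0\\0&1\end{pmatrix},\ \nu_1=\tfrac1{\sqrt2}\begin{pmatrix}1&1\\1&-1\end{pmatrix},\ \nu_2=\tfrac1{\sqrt2}\begin{pmatrix}1&1\\-1&1\end{pmatrix},\ \nu_3=\begin{pmatrix}0&1\\1&0\end{pmatrix},$$ $$\nu_4=\begin{pmatrix}0&1\\-1&0\end{pmatrix},\ \nu_5=\tfrac1{\sqrt2}\begin{pmatrix}-1&1\\1&1\end{pmatrix},\ \nu_6=\tfrac1{\sqrt2}\begin{pmatrix}-1&1\\-1&-1\end{pmatrix},\ \nu_7=\begin{pmatrix}-1&0\\0&1\end{pmatrix}.$$ Points of $\mathbb{RP}^1$ are given by the inverse slope coordinate $u=x/y\in\mathbb{R}\cup\{\infty\}$ or the angle $\theta\in[0,\pi]$, $u=\cot\theta$. A matrix $L=\begin{pmatrix}a&b\\c&d\end{pmatrix}$ acts by $L[u]=\frac{au+b}{cu+d}$. $\Sigma_i$ is the sector with angles $[i\pi/8,(i+1)\pi/8)$, $0\le i\le7$, with closure $\overline\Sigma_i$, and $\Sigma=\Sigma_1\cup\dots\cup\Sigma_7$,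 which in the $u$ coordinate is the interval from $-\infty$ to $1+\sqrt2=\cot(\pi/8)$. The octagon Farey map is $F(u)=\gamma\nu_i[u]$ for $u\in\overline\Sigma_i$; it is a continuous map. Each branch maps $\overline\Sigma_i$ onto $\overline\Sigma=\overline\Sigma_1\cup\dots\cup\overline\Sigma_7$. *)

theory Defs
  imports "HOL-Analysis.Analysis"
begin

text \<open>
  A point of the real projective line is given by its inverse slope coordinate \<open>u = x / y\<close>:
  \<open>Some u\<close> stands for a real \<open>u\<close> and \<open>None\<close> for \<open>u = \<infinity>\<close>.
\<close>

type_synonym rp1 = "real option"

abbreviation rp1_topology :: "rp1 topology"
  where "rp1_topology \<equiv> Alexandroff_compactification euclideanreal"

definition rp1_borel :: "rp1 measure"
  where "rp1_borel = sigma UNIV {U. openin rp1_topology U}"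

text \<open>The angles \<open>0\<close> and \<open>pi\<close> both give the point \<open>\<infinity>\<close>.\<close>

definition rp1_of_angle :: "real \<Rightarrow> rp1"
  where "rp1_of_angle \<theta> = (if sin \<theta> = 0 then None else Some (cot \<theta>))"

definition mat2 :: "real \<Rightarrow> real \<Rightarrow> real \<Rightarrow> real \<Rightarrow> real^2^2"
  where "mat2 a b c d = vector [vector [a, b], vector [c, d]]"

text \<open>
  The action \<open>L[u] = (a u + b) / (c u + d)\<close> of an invertible matrix, including the usual
  conventions \<open>L[-d/c] = \<infinity>\<close> and \<open>L[\<infinity>] = a / c\<close>.
\<close>

definition rp1_act :: "real^2^2 \<Rightarrow> rp1 \<Rightarrow> rp1"
  where "rp1_act L p = (case p of
      Some u \<Rightarrow> (if L$2$1 * u + L$2$2 = 0 then None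
                 else Some ((L$1$1 * u + L$1$2) / (L$2$1 * u + L$2$2)))
    | None \<Rightarrow> (if L$2$1 = 0 then None else Some (L$1$1 / L$2$1)))"

definition oct_gamma :: "real^2^2"
  where "oct_gamma = mat2 (-1) (2 * (1 + sqrt 2)) 0 1"

definition oct_nu :: "nat \<Rightarrow> real^2^2"
  where "oct_nu i =
    [mat2 1 0 0 1,
     (1 / sqrt 2) *\<^sub>R mat2 1 1 1 (-1),
     (1 / sqrt 2) *\<^sub>R mat2 1 1 (-1) 1,
     mat2 0 1 1 0,
     mat2 0 1 (-1) 0,
     (1 / sqrt 2) *\<^sub>R mat2 (-1) 1 1 1,
     (1 / sqrt 2) *\<^sub>R mat2 (-1) 1 (-1) (-1),
     mat2 (-1) 0 0 1] ! i"

definition oct_sector :: "nat \<Rightarrow> rp1 set"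
  where "oct_sector i = rp1_of_angle ` {real i * pi / 8 ..< real (i + 1) * pi / 8}"

definition oct_closed_sector :: "nat \<Rightarrow> rp1 set"
  where "oct_closed_sector i = rp1_topology closure_of oct_sector i"

definition oct_Sigma :: "rp1 set"
  where "oct_Sigma = (\<Union>i\<in>{1..7}. oct_sector i)"

text \<open>
  The closed sectors overlap at their endpoints, where the neighbouring branches agree; see
  \<open>octagon_Farey_eq\<close> below.
\<close>

definition octagon_Farey :: "rp1 \<Rightarrow> rp1"
  where "octagon_Farey p =
    (THE q. \<forall>i<8. p \<in> oct_closed_sector i \<longrightarrow> q = rp1_act (oct_gamma ** oct_nu i) p)"

definition farey_measure :: "rp1 measure"
  where "farey_measure =
    distr (density (restrict_space lborel {u. Some u \<in> oct_Sigma})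
            (\<lambda>u. ennreal (1 / (1 + sqrt 2 - u))))
          (restrict_space rp1_borel oct_Sigma) Some"

text \<open>The closed sectors in the coordinate \<open>u\<close>; only the inclusion is needed below.\<close>

definition oct_box :: "nat \<Rightarrow> rp1 set" where
  "oct_box i = [insert None (Some ` {1 + sqrt 2..}), Some ` {1..1 + sqrt 2}, Some ` {sqrt 2 - 1..1},
     Some ` {0..sqrt 2 - 1}, Some ` {1 - sqrt 2..0}, Some ` {-1..1 - sqrt 2},
     Some ` {-1 - sqrt 2..-1}, insert None (Some ` {..-1 - sqrt 2})] ! i"

lemma oct_less8: "i < 8 \<longleftrightarrow> i = 0 \<or> i = 1 \<or> i = 2 \<or> i = 3 \<or> i = 4 \<or> i = 5 \<or> i = 6 \<or> i = (7::nat)"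
  by auto

lemma closed_box:
  assumes "i < 8" shows "closedin rp1_topology (oct_box i)"
proof -
  have 1: "closedin rp1_topology (insert None (Some ` A))" if "closed A" for A :: "real set"
  proof -
    have "insert None (Some ` A) = topspace rp1_topology - Some ` (- A)" by auto
    moreover have "openin euclideanreal (- A)" using that by (simp add: open_Compl)
    ultimately show ?thesis unfolding closedin_Alexandroff_compactification by blast
  qed
  have 2: "closedin rp1_topology (Some ` {a..b})" for a b :: real by simp
  from assms have "i \<in> {0, 1, 2, 3, 4, 5, 6, 7}" by auto
  then show ?thesis
    by (elim insertE emptyE) (simp_all add: oct_box_def 1 2)
qed

lemma cot_pi_8: "cot (pi/8) = 1 + sqrt 2"
proof -
  have s: "sin (pi/8) > 0" by (rule sin_gt_zero) auto
  have "sin (2*(pi/8)) = 2 * sin (pi/8) * cos (pi/8)" by (rule sin_double)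
  moreover have "cos (2*(pi/8)) = 2 * (cos (pi/8))\<^sup>2 - 1" by (rule cos_double_cos)
  moreover have "2 * (pi/8) = pi/4" by simp
  ultimately have a: "2 * sin (pi/8) * cos (pi/8) = sqrt 2/2" "2 * (cos (pi/8))\<^sup>2 = 1 + sqrt 2/2"
    using sin_45 cos_45 by (metis, smt (verit))
  have "cos (pi/8) > 0" by (rule cos_gt_zero) auto
  have "cos (pi/8) * (2 * sin (pi/8) * cos (pi/8)) * (1 + sqrt 2) * 2
     = cos (pi/8) * (sqrt 2 + 2)" unfolding a by (simp add: algebra_simps)
  also have "\<dots> = cos (pi/8) * (2 * (2 * (cos (pi/8))\<^sup>2))" unfolding a by simp
  finally have "sin (pi/8) * (1 + sqrt 2) * (4 * (cos (pi/8))\<^sup>2) = cos (pi/8) * (4 * (cos (pi/8))\<^sup>2)"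
    by (simp add: power2_eq_square algebra_simps)
  then have "sin (pi/8) * (1 + sqrt 2) = cos (pi/8)" using \<open>cos (pi/8) > 0\<close> by simp
  then show ?thesis using s by (simp add: cot_def field_simps)
qed

lemma cot_pi_minus: "cot (pi - x) = - cot (x::real)" by (simp add: cot_def)
lemma cot_half_minus: "cot (pi/2 - x) = 1 / cot (x::real)"
  by (simp add: cot_def sin_diff cos_diff)

lemma cot_mono: assumes "0 < x" "x \<le> y" "y < pi" shows "cot y \<le> cot (x::real)"
proof -
  have "sin x > 0" "sin y > 0" using assms by (auto intro: sin_gt_zero)
  moreover have "sin (y - x) \<ge> 0" using assms by (intro sin_ge_zero) auto
  ultimately show ?thesis by (simp add: cot_def sin_diff field_simps)
qed

lemma inv_c: "1 / (1 + sqrt 2) = sqrt 2 - 1"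
  by (simp add: field_simps add_pos_pos add_nonneg_eq_0_iff)

lemma cot_vals:
  "cot (2*pi/8) = 1" "cot (3*pi/8) = sqrt 2 - 1" "cot (4*pi/8) = (0::real)"
  "cot (5*pi/8) = 1 - sqrt 2" "cot (6*pi/8) = (-1::real)" "cot (7*pi/8) = -1 - sqrt 2"
proof -
  show a: "cot (2*pi/8) = (1::real)" by (simp add: cot_def sin_45 cos_45)
  have e: "3*pi/8 = pi/2 - pi/8" "5*pi/8 = pi - 3*pi/8" "6*pi/8 = pi - 2*pi/8" "7*pi/8 = pi - pi/8"
    "4*pi/8 = pi/2"
    by simp_all
  show b: "cot (3*pi/8) = sqrt 2 - 1" unfolding e cot_half_minus cot_pi_8 by (rule inv_c)
  show "cot (4*pi/8) = (0::real)" unfolding e by (simp add: cot_def)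
  show "cot (5*pi/8) = 1 - sqrt 2" unfolding e(2) cot_pi_minus b by simp
  show "cot (6*pi/8) = (-1::real)" unfolding e(3) cot_pi_minus a by simp
  show "cot (7*pi/8) = -1 - sqrt 2" unfolding e(4) cot_pi_minus cot_pi_8 by simp
qed

lemma sector_box:
  assumes "i < 8" shows "oct_sector i \<subseteq> oct_box i"
proof
  fix p assume "p \<in> oct_sector i"
  then obtain t where t: "p = rp1_of_angle t" "real i * pi / 8 \<le> t" "t < real (i+1) * pi / 8"
    by (auto simp: oct_sector_def)
  show "p \<in> oct_box i"
  proof (cases "t = 0")
    case True
    then have "i = 0 \<or> i \<noteq> 0 \<and> real i * pi / 8 \<le> 0" using t by auto
    then have "i = 0" using pi_gt_zero by (auto simp: field_simps mult_le_0_iff)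
    with True t show ?thesis by (simp add: rp1_of_angle_def oct_box_def)
  next
    case False
    have "0 \<le> real i * pi/8" by simp
    with t False have t0: "t > 0" by linarith
    have "real (i+1) * pi \<le> 8 * pi" using assms by (intro mult_right_mono) auto
    with t have tp: "t < pi" by linarith
    have "sin t > 0" using t0 tp by (rule sin_gt_zero)
    then have p: "p = Some (cot t)" by (simp add: t rp1_of_angle_def)
    have lo: "cot (real (i+1) * pi/8) \<le> cot t" if "i < 7"
      using cot_mono[OF t0 less_imp_le[OF t(3)]] that by (simp add: field_simps)
    have hi: "cot t \<le> cot (real i * pi/8)" if "i > 0"
      using cot_mono[OF _ t(2) tp] that by simp
    show ?thesis using assms lo hi cot_vals cot_pi_8 unfolding oct_less8 p oct_box_def
      by (elim disjE) (simp_all)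
  qed
qed

lemma closed_sector_box:
  assumes "i < 8" shows "oct_closed_sector i \<subseteq> oct_box i"
  unfolding oct_closed_sector_def
  by (rule closure_of_minimal[OF sector_box closed_box]) fact+

lemma sector_cover: "\<exists>i<8. p \<in> oct_sector i"
proof -
  have "\<exists>t. 0 \<le> t \<and> t < pi \<and> p = rp1_of_angle t"
  proof (cases p)
    case None
    then show ?thesis by (intro exI[of _ 0]) (auto simp: rp1_of_angle_def)
  next
    case (Some u)
    let ?t = "pi/2 - arctan u"
    have "cos (arctan u) \<noteq> 0" "sin (arctan u) / cos (arctan u) = u"
      using tan_arctan[of u] by (auto simp: tan_def)
    then have "rp1_of_angle ?t = Some u" by (simp add: rp1_of_angle_def cot_def sin_diff cos_diff)
    with Some show ?thesis using arctan_bounded[of u] by (intro exI[of _ ?t]) auto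
  qed
  then obtain t where t: "0 \<le> t" "t < pi" "p = rp1_of_angle t" by auto
  define i where "i = nat \<lfloor>8 * t / pi\<rfloor>"
  have "real i \<le> 8*t/pi" "8*t/pi < real i + 1"
    using t unfolding i_def by (simp_all)
  moreover have "8*t/pi < 8" using t by (simp add: field_simps)
  moreover from calculation have "i < 8" by linarith
  ultimately show ?thesis using t(3) unfolding oct_sector_def
    by (intro exI[of _ i]) (auto simp: field_simps)
qed

lemma sector_subset_closed: "oct_sector i \<subseteq> oct_closed_sector i"
  unfolding oct_closed_sector_def by (rule closure_of_subset) (simp add: UNIV_option_conv [symmetric])

lemma sqrt2_bounds: "1 < sqrt 2" "sqrt 2 < 2"
  using real_less_rsqrt[of 1 2] real_sqrt_less_iff[of 2 4] by auto

lemma act_scale: "k \<noteq> 0 \<Longrightarrow> rp1_act (k *\<^sub>R L) p = rp1_act L p"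
proof -
  assume k: "k \<noteq> 0"
  have "k * a * u + k * b = k * (a * u + b)" for a b u by (simp add: algebra_simps)
  then show ?thesis using k by (auto simp: rp1_act_def split: option.splits)
qed

lemma mult_scale: "A ** (k *\<^sub>R B) = k *\<^sub>R (A ** (B :: real^2^2))"
  by (simp add: vec_eq_iff matrix_matrix_mult_def sum_distrib_left algebra_simps)

lemma mat2_nth [simp]: "mat2 a b c d $1$1 = a" "mat2 a b c d $1$2 = b" "mat2 a b c d $2$1 = c" "mat2 a b c d $2$2 = d"
  by (simp_all add: mat2_def)

lemma mat2_mult: "mat2 a b c d ** mat2 a' b' c' d' = mat2 (a*a'+b*c') (a*b'+b*d') (c*a'+d*c') (c*b'+d*d')"
  by (simp add: vec_eq_iff forall_2 matrix_matrix_mult_def sum_2)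

lemma end_vals:
  "rp1_act (oct_gamma ** oct_nu 0) None = None" "rp1_act (oct_gamma ** oct_nu 7) None = None"
  "rp1_act (oct_gamma ** oct_nu 0) (Some (1 + sqrt 2)) = Some (1 + sqrt 2)"
  "rp1_act (oct_gamma ** oct_nu (Suc 0)) (Some (1 + sqrt 2)) = Some (1 + sqrt 2)"
  "rp1_act (oct_gamma ** oct_nu (Suc 0)) (Some 1) = None"
  "rp1_act (oct_gamma ** oct_nu 2) (Some 1) = None"
  "rp1_act (oct_gamma ** oct_nu 2) (Some (sqrt 2 - 1)) = Some (1 + sqrt 2)"
  "rp1_act (oct_gamma ** oct_nu 3) (Some (sqrt 2 - 1)) = Some (1 + sqrt 2)"
  "rp1_act (oct_gamma ** oct_nu 3) (Some 0) = None"
  "rp1_act (oct_gamma ** oct_nu 4) (Some 0) = None"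
  "rp1_act (oct_gamma ** oct_nu 4) (Some (1 - sqrt 2)) = Some (1 + sqrt 2)"
  "rp1_act (oct_gamma ** oct_nu 5) (Some (1 - sqrt 2)) = Some (1 + sqrt 2)"
  "rp1_act (oct_gamma ** oct_nu 5) (Some (-1)) = None"
  "rp1_act (oct_gamma ** oct_nu 6) (Some (-1)) = None"
  "rp1_act (oct_gamma ** oct_nu 6) (Some (-1 - sqrt 2)) = Some (1 + sqrt 2)"
  "rp1_act (oct_gamma ** oct_nu 7) (Some (-1 - sqrt 2)) = Some (1 + sqrt 2)"
  using sqrt2_bounds
  by (simp_all add: oct_nu_def oct_gamma_def mult_scale act_scale mat2_mult rp1_act_def field_simps)

lemma box_None: "i < 8 \<Longrightarrow> None \<in> oct_box i \<longleftrightarrow> i = 0 \<or> i = 7"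
  by (elim oct_less8 [THEN iffD1, elim_format] disjE) (simp_all add: oct_box_def image_iff)

definition oct_cut :: "nat \<Rightarrow> real" where
  "oct_cut i = [1 + sqrt 2, 1, sqrt 2 - 1, 0, 1 - sqrt 2, -1, -1 - sqrt 2] ! i"

lemma box_le: "i < 8 \<Longrightarrow> 0 < i \<Longrightarrow> Some u \<in> oct_box i \<Longrightarrow> u \<le> oct_cut (i - 1)"
  by (elim oct_less8 [THEN iffD1, elim_format] disjE) (simp_all add: oct_box_def oct_cut_def image_iff)

lemma box_ge: "i < 7 \<Longrightarrow> Some u \<in> oct_box i \<Longrightarrow> oct_cut i \<le> u"
proof -
  assume "i < 7" "Some u \<in> oct_box i"
  moreover from this have "i \<in> {0, 1, 2, 3, 4, 5, 6}" by auto
  ultimately show ?thesis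
    by (elim insertE emptyE) (simp_all add: oct_box_def oct_cut_def image_iff)
qed

lemma cut_Suc: "Suc i < 7 \<Longrightarrow> oct_cut (Suc i) < oct_cut i"
proof -
  assume "Suc i < 7"
  then have "i \<in> {0, 1, 2, 3, 4, 5}" by auto
  then show ?thesis using sqrt2_bounds
    by (elim insertE emptyE) (simp_all add: oct_cut_def)
qed

lemma cut_less: "i < j \<Longrightarrow> j < 7 \<Longrightarrow> oct_cut j < oct_cut i"
proof (induction j)
  case (Suc j)
  then show ?case using cut_Suc[of j] by (cases "i = j") auto
qed simp

lemma box_inter:
  assumes "i < j" "j < 8" "p \<in> oct_box i" "p \<in> oct_box j"
  shows "i = 0 \<and> j = 7 \<and> p = None \<or> j = Suc i \<and> p = Some (oct_cut i)"
proof (cases p)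
  case None
  then show ?thesis using assms box_None[of i] box_None[of j] by auto
next
  case (Some u)
  with assms have "u \<le> oct_cut (j - 1)" "oct_cut i \<le> u"
    using box_le[of j u] box_ge[of i u] by auto
  moreover have "i = j - 1" if "oct_cut i \<le> oct_cut (j - 1)"
  proof (rule ccontr)
    assume "i \<noteq> j - 1"
    then have "oct_cut (j - 1) < oct_cut i" using assms by (intro cut_less) auto
    with that show False by simp
  qed
  ultimately show ?thesis using assms Some by auto
qed

lemma cut_agree:
  assumes "i < 7"
  shows "rp1_act (oct_gamma ** oct_nu i) (Some (oct_cut i))
       = rp1_act (oct_gamma ** oct_nu (Suc i)) (Some (oct_cut i))"
proof -
  have "i \<in> {0, 1, 2, 3, 4, 5, 6}" using assms by auto
  then show ?thesis using end_vals
    by (elim insertE emptyE) (simp_all add: oct_cut_def eval_nat_numeral)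
qed

lemma branch_agree:
  assumes "i < 8" "j < 8" "p \<in> oct_box i" "p \<in> oct_box j"
  shows "rp1_act (oct_gamma ** oct_nu i) p = rp1_act (oct_gamma ** oct_nu j) p"
proof -
  have *: "rp1_act (oct_gamma ** oct_nu i) p = rp1_act (oct_gamma ** oct_nu j) p"
    if "i < j" "j < 8" "p \<in> oct_box i" "p \<in> oct_box j" for i j
    using box_inter[OF that]
  proof
    assume "i = 0 \<and> j = 7 \<and> p = None"
    then show ?thesis using end_vals(1,2) by simp
  next
    assume "j = Suc i \<and> p = Some (oct_cut i)"
    then show ?thesis using cut_agree[of i] \<open>j < 8\<close> by simp
  qed
  consider "i < j" | "i = j" | "j < i" by linarith
  then show ?thesis
  proof cases
    case 1
    then show ?thesis using * assms by blast
  next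
    case 3
    then show ?thesis using *[of j i] assms by metis
  qed simp
qed

lemma octagon_Farey_eq:
  assumes "i < 8" "p \<in> oct_closed_sector i"
  shows "octagon_Farey p = rp1_act (oct_gamma ** oct_nu i) p"
  unfolding octagon_Farey_def
proof (rule the_equality)
  show "\<forall>j<8. p \<in> oct_closed_sector j \<longrightarrow>
        rp1_act (oct_gamma ** oct_nu i) p = rp1_act (oct_gamma ** oct_nu j) p"
    using assms branch_agree closed_sector_box by blast
qed (use assms in blast)

lemma measurable_Some_rp1_borel: "Some \<in> borel \<rightarrow>\<^sub>M rp1_borel"
  unfolding rp1_borel_def
proof (rule measurable_measure_of)
  fix U assume "U \<in> {U. openin rp1_topology U}"
  then have "openin euclideanreal {x \<in> topspace euclideanreal. Some x \<in> U}"
    using continuous_map_Some[of euclideanreal] by (auto simp: continuous_map_def)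
  then show "Some -` U \<inter> space borel \<in> sets borel" by (simp add: vimage_def)
qed auto
end

theory Submission
  imports Defs
begin

text \<open>
  Write \<open>c = 1 + sqrt 2\<close>, so that \<open>\<Sigma>\<close> is the half-line \<open>u \<le> c\<close>, and let \<open>T\<^sub>i = \<gamma> \<nu>\<^sub>i\<close> be the
  branches. The set \<open>\<Sigma>\<^sub>0\<close>, which is the half-line \<open>y \<ge> c\<close> together with \<open>\<infinity>\<close>, is the complement of
  \<open>\<Sigma>\<close> up to endpoints, and the density is \<open>1 / (c - s) = \<integral> dy / (y - s)\<^sup>2\<close>, the integral being
  over \<open>y \<in> \<Sigma>\<^sub>0\<close>. The measure \<open>dx dy / (x - y)\<^sup>2\<close> is preserved by the diagonal action of every
  real Moebius map, orientation reversing or not. So the branch \<open>T\<^sub>i\<close>, which carries \<open>\<Sigma>\<^sub>i\<close> onto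
  \<open>\<Sigma>\<close> up to endpoints, pushes the measure \<open>\<mu>\<close> restricted to \<open>\<Sigma>\<^sub>i\<close> to the measure with density
  \<open>\<integral> dy / (y - s)\<^sup>2\<close> over \<open>y \<in> T\<^sub>i \<Sigma>\<^sub>0\<close>. The seven sets
  \<open>T\<^sub>1 \<Sigma>\<^sub>0, T\<^sub>6 \<Sigma>\<^sub>0, T\<^sub>3 \<Sigma>\<^sub>0, T\<^sub>4 \<Sigma>\<^sub>0, T\<^sub>5 \<Sigma>\<^sub>0, T\<^sub>2 \<Sigma>\<^sub>0, T\<^sub>7 \<Sigma>\<^sub>0\<close> are consecutive intervals that
  tile \<open>\<Sigma>\<^sub>0\<close>; hence the seven densities add up to \<open>1 / (c - s)\<close>, which is the invariance.

  The integral over \<open>T\<^sub>i \<Sigma>\<^sub>0\<close> is a difference of two reciprocals, whose poles \<open>T\<^sub>i[c]\<close> and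
  \<open>T\<^sub>i[\<infinity>]\<close> are the ends of the tile; for \<open>i = 7\<close> the end \<open>T\<^sub>i[\<infinity>]\<close> is \<open>\<infinity>\<close> and contributes nothing.
  In this form the push-forward is a one-variable substitution followed by a partial fraction
  decomposition (\<open>branch_density_increasing\<close>, \<open>branch_density_decreasing\<close>,
  \<open>branch_density_translation\<close>), and the addition of the seven densities is a telescoping sum. As
  \<open>\<mu>\<close> is infinite, all integrals are taken with values in the extended nonnegative reals. What
  remains is to pass between the projective line and the coordinate \<open>u\<close>; the endpoints of the
  sectors form a finite set and may be ignored.
\<close>

section \<open>Substitution on a half-line\<close>

text \<open>
  The substitution rule for compact intervals passes to the open half-line by exhausting it with
  the intervals \<open>[c - n, c - 1/n]\<close>: both sides are measures, possibly infinite, of an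
  increasing union.
\<close>

lemma nn_integral_substitution_lessThan:
  fixes f g g' :: "real \<Rightarrow> real" and c :: real
  assumes f [measurable]: "f \<in> borel_measurable borel"
    and der: "\<And>x. x < c \<Longrightarrow> (g has_real_derivative g' x) (at x)"
    and cont: "continuous_on {..<c} g'"
    and nonneg: "\<And>x. x < c \<Longrightarrow> 0 \<le> g' x"
    and img: "g ` {..<c} = S"
    and S [measurable]: "S \<in> sets borel" and g' [measurable]: "g' \<in> borel_measurable borel"
    and g [measurable]: "g \<in> borel_measurable borel"
  shows "(\<integral>\<^sup>+u. ennreal (f u * indicator S u) \<partial>lborel)
    = (\<integral>\<^sup>+s. ennreal (f (g s) * g' s * indicator {..<c} s) \<partial>lborel)"
proof -
  define a b where "a n = c - real (Suc n)" and "b n = c - 1 / real (Suc n)" for n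
  have bc: "b n < c" for n by (simp add: b_def)
  have ab: "a n \<le> b n" for n
    unfolding a_def b_def by (simp add: field_simps)
  have a_anti: "a n \<le> a m" and b_mono: "b m \<le> b n" if "m \<le> n" for m n
    using that unfolding a_def b_def by (auto simp: frac_le)
  have mono: "g x \<le> g y" if "x \<le> y" "y < c" for x y
    using that by (intro DERIV_nonneg_imp_nondecreasing[of x y g]) (meson der nonneg le_less_trans)+
  have ex: "\<exists>n. s \<in> {a n..b n}" if "s < c" for s
  proof -
    obtain n where n: "max (c - s) (1 / (c - s)) < real n" using reals_Archimedean2 by blast
    then have "c - s \<le> real (Suc n)" "1 / (c - s) \<le> real (Suc n)" by auto
    with that have "s \<in> {a n..b n}" unfolding a_def b_def by (auto simp: field_simps)
    then show ?thesis ..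
  qed
  have un1: "(\<Union>n. {a n..b n}) = {..<c}"
    using ex bc by (auto intro: le_less_trans)
  have un2: "(\<Union>n. {g (a n)..g (b n)}) = S"
  proof (intro set_eqI iffI)
    fix y assume "y \<in> S"
    then obtain s where s: "s < c" "y = g s" using img by auto
    with ex obtain n where "s \<in> {a n..b n}" by blast
    then show "y \<in> (\<Union>n. {g (a n)..g (b n)})"
      using s mono[of "a n" s] mono[of s "b n"] bc by auto
  next
    fix y assume "y \<in> (\<Union>n. {g (a n)..g (b n)})"
    then obtain n where n: "g (a n) \<le> y" "y \<le> g (b n)" by auto
    have "continuous_on {a n..b n} g"
      using bc[of n]
      by (intro DERIV_continuous_on[where D = g'] has_field_derivative_at_within[OF der]) simp
    then obtain x where "a n \<le> x" "x \<le> b n" "g x = y" using IVT'[OF n ab] by blast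
    then show "y \<in> S" using img bc[of n] by auto
  qed
  define M where "M = density lborel (\<lambda>u. ennreal (f u))"
  define N where "N = density lborel (\<lambda>s. ennreal (f (g s) * g' s))"
  have ind: "ennreal r * indicator A x = ennreal (r * indicator A x)" for r and A :: "real set" and x
    by (simp split: split_indicator)
  have step: "emeasure M {g (a n)..g (b n)} = emeasure N {a n..b n}" for n
  proof -
    have "(\<integral>\<^sup>+u. ennreal (f u * indicator {g (a n)..g (b n)} u) \<partial>lborel)
      = (\<integral>\<^sup>+s. ennreal (f (g s) * g' s * indicator {a n..b n} s) \<partial>lborel)"
      using bc[of n] by (intro nn_integral_substitution der nonneg ab continuous_on_subset[OF cont])
        (auto simp: set_borel_measurable_def)
    then show ?thesis by (simp add: M_def N_def emeasure_density ind)
  qed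
  have incs: "incseq (\<lambda>n. {a n..b n})" "incseq (\<lambda>n. {g (a n)..g (b n)})"
  proof -
    have "{a m..b m} \<subseteq> {a n..b n} \<and> {g (a m)..g (b m)} \<subseteq> {g (a n)..g (b n)}" if "m \<le> n" for m n
    proof -
      note le = a_anti[OF that] b_mono[OF that]
      have "g (a n) \<le> g (a m)" "g (b m) \<le> g (b n)"
        using le ab[of m] bc[of m] bc[of n] by (intro mono; linarith)+
      then show ?thesis using le by simp
    qed
    then show "incseq (\<lambda>n. {a n..b n})" "incseq (\<lambda>n. {g (a n)..g (b n)})"
      unfolding incseq_def by blast+
  qed
  have "emeasure M S = (SUP n. emeasure M {g (a n)..g (b n)})"
    unfolding un2[symmetric] by (rule SUP_emeasure_incseq[symmetric]) (auto simp: M_def incs)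
  also have "\<dots> = (SUP n. emeasure N {a n..b n})" by (simp add: step)
  also have "\<dots> = emeasure N {..<c}"
    unfolding un1[symmetric] by (rule SUP_emeasure_incseq) (auto simp: N_def incs)
  finally show ?thesis by (simp add: M_def N_def emeasure_density ind)
qed

text \<open>
  The maps \<open>s \<mapsto> m \<plusminus> \<kappa> / (Q - s)\<close> are the inverses of the Moebius maps \<open>u \<mapsto> Q \<mp> \<kappa> / (u - m)\<close>, which
  have their pole at \<open>m\<close> and take the value \<open>Q\<close> at \<open>\<infinity>\<close>; every nonaffine Moebius map has one of
  these two forms.
\<close>

lemma moebius_image:
  fixes c Q m \<kappa> :: real
  assumes "\<kappa> > 0" "c < Q"
  shows "(\<lambda>s. m + \<kappa> / (Q - s)) ` {..<c} = {m<..<m + \<kappa> / (Q - c)}"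
proof (intro set_eqI iffI)
  fix u assume "u \<in> {m<..<m + \<kappa> / (Q - c)}"
  then have "0 < u - m" "u - m < \<kappa> / (Q - c)" by auto
  then have "Q - \<kappa> / (u - m) < c" "u = m + \<kappa> / (Q - (Q - \<kappa> / (u - m)))"
    using assms by (auto simp: field_simps)
  then show "u \<in> (\<lambda>s. m + \<kappa> / (Q - s)) ` {..<c}" by blast
qed (use assms in \<open>auto intro!: divide_strict_left_mono\<close>)

lemma nn_integral_moebius:
  fixes f :: "real \<Rightarrow> real" and c Q m \<kappa> :: real
  assumes f: "f \<in> borel_measurable borel" and "\<kappa> > 0" "c < Q"
  shows "(\<integral>\<^sup>+u. ennreal (f u * indicator {m<..<m + \<kappa> / (Q - c)} u) \<partial>lborel)
    = (\<integral>\<^sup>+s. ennreal (f (m + \<kappa> / (Q - s)) * (\<kappa> / (Q - s)\<^sup>2) * indicator {..<c} s) \<partial>lborel)"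
proof (rule nn_integral_substitution_lessThan[OF f])
  show "((\<lambda>s. m + \<kappa> / (Q - s)) has_real_derivative \<kappa> / (Q - x)\<^sup>2) (at x)" if "x < c" for x
    using that assms by (auto intro!: derivative_eq_intros simp: power2_eq_square)
  show "continuous_on {..<c} (\<lambda>s. \<kappa> / (Q - s)\<^sup>2)"
    using assms by (auto intro!: continuous_intros)
qed (use assms in \<open>auto simp: moebius_image intro!: divide_nonneg_pos\<close>)

lemma nn_integral_moebius_reflected:
  fixes f :: "real \<Rightarrow> real" and c Q m \<kappa> :: real
  assumes f [measurable]: "f \<in> borel_measurable borel" and "\<kappa> > 0" "c < Q"
  shows "(\<integral>\<^sup>+u. ennreal (f u * indicator {m - \<kappa> / (Q - c)<..<m} u) \<partial>lborel)
    = (\<integral>\<^sup>+s. ennreal (f (m - \<kappa> / (Q - s)) * (\<kappa> / (Q - s)\<^sup>2) * indicator {..<c} s) \<partial>lborel)"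
proof -
  have "(\<integral>\<^sup>+u. ennreal (f u * indicator {m - \<kappa> / (Q - c)<..<m} u) \<partial>lborel)
     = (\<integral>\<^sup>+u. ennreal (f (-u) * indicator {-m<..<-m + \<kappa> / (Q - c)} u) \<partial>lborel)"
    by (subst nn_integral_real_affine[where c = "-1" and t = 0])
      (auto intro!: nn_integral_cong simp: indicator_def)
  also have "\<dots> = (\<integral>\<^sup>+s. ennreal (f (- (- m + \<kappa> / (Q - s))) * (\<kappa> / (Q - s)\<^sup>2) * indicator {..<c} s) \<partial>lborel)"
    using assms by (intro nn_integral_moebius) auto
  finally show ?thesis by simp
qed

section \<open>Push-forward of the density by one branch\<close>

text \<open>
  The two poles of the new density are the values of the branch \<open>u \<mapsto> Q - \<kappa> / (u - m)\<close> at \<open>\<infinity>\<close> and at \<open>c\<close>,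
  because the density \<open>1 / (c - u)\<close> itself is \<open>1 / (c - u) - 1 / (\<infinity> - u)\<close> and the differential
  \<open>du / (p - u) - du / (q - u)\<close> is carried by a Moebius map to the one with the image poles.
\<close>

lemma branch_density_increasing:
  fixes c Q m \<kappa> :: real and B :: "real set"
  assumes [measurable]: "B \<in> sets borel" and "\<kappa> > 0" "c < Q" "m + \<kappa> / (Q - c) \<le> c"
  shows "(\<integral>\<^sup>+u. ennreal (indicator B (Q - \<kappa> / (u - m)) * (1 / (c - u))
            * indicator {m<..<m + \<kappa> / (Q - c)} u) \<partial>lborel)
    = (\<integral>\<^sup>+s. ennreal (indicator B s * (1 / (Q - \<kappa> / (c - m) - s) - 1 / (Q - s))
            * indicator {..<c} s) \<partial>lborel)"
proof -
  have "0 < \<kappa> / (Q - c)" using assms by simp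
  then have m: "m < c" using assms by linarith
  have cross: "1 / (c - (m + \<kappa> / (Q - s))) * (\<kappa> / (Q - s)\<^sup>2)
      = 1 / (Q - \<kappa> / (c - m) - s) - 1 / (Q - s)" if "s < c" for s
  proof -
    have "\<kappa> / (Q - s) < \<kappa> / (Q - c)" using that assms by (intro divide_strict_left_mono) auto
    then have "\<kappa> / (Q - s) < c - m" using assms by linarith
    then have a: "\<kappa> < (c - m) * (Q - s)" using that assms by (simp add: field_simps)
    define p where "p = (c - m) * (Q - s) - \<kappa>"
    have "c - (m + \<kappa> / (Q - s)) = p / (Q - s)" "Q - \<kappa> / (c - m) - s = p / (c - m)"
      using that assms m by (auto simp: p_def field_simps)
    moreover have "(c - m) / p - 1 / (Q - s) = \<kappa> / (p * (Q - s))"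
      using that assms a by (simp add: p_def divide_simps)
    ultimately show ?thesis using that assms by (simp add: power2_eq_square)
  qed
  have "(\<integral>\<^sup>+u. ennreal (indicator B (Q - \<kappa> / (u - m)) * (1 / (c - u))
            * indicator {m<..<m + \<kappa> / (Q - c)} u) \<partial>lborel)
    = (\<integral>\<^sup>+s. ennreal (indicator B (Q - \<kappa> / (m + \<kappa> / (Q - s) - m))
            * (1 / (c - (m + \<kappa> / (Q - s)))) * (\<kappa> / (Q - s)\<^sup>2) * indicator {..<c} s) \<partial>lborel)"
    using assms by (intro nn_integral_moebius) auto
  also have "\<dots> = (\<integral>\<^sup>+s. ennreal (indicator B s * (1 / (Q - \<kappa> / (c - m) - s) - 1 / (Q - s))
            * indicator {..<c} s) \<partial>lborel)"
  proof (intro nn_integral_cong arg_cong[where f = ennreal])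
    fix s show "indicator B (Q - \<kappa> / (m + \<kappa> / (Q - s) - m))
            * (1 / (c - (m + \<kappa> / (Q - s)))) * (\<kappa> / (Q - s)\<^sup>2) * indicator {..<c} s
       = indicator B s * (1 / (Q - \<kappa> / (c - m) - s) - 1 / (Q - s)) * (indicator {..<c} s :: real)"
    proof (cases "s < c")
      case True
      then show ?thesis using assms unfolding mult.assoc[of _ "1 / _"] cross[OF True] by simp
    qed simp
  qed
  finally show ?thesis .
qed

text \<open>
  For a decreasing branch the sign of \<open>du\<close> changes, so the poles enter in the opposite order.
\<close>

lemma branch_density_decreasing:
  fixes c Q m \<kappa> :: real and B :: "real set"
  assumes [measurable]: "B \<in> sets borel" and "\<kappa> > 0" "c < Q" "m < c"
  shows "(\<integral>\<^sup>+u. ennreal (indicator B (Q + \<kappa> / (u - m)) * (1 / (c - u))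
            * indicator {m - \<kappa> / (Q - c)<..<m} u) \<partial>lborel)
    = (\<integral>\<^sup>+s. ennreal (indicator B s * (1 / (Q - s) - 1 / (Q + \<kappa> / (c - m) - s))
            * indicator {..<c} s) \<partial>lborel)"
proof -
  have cross: "1 / (c - (m - \<kappa> / (Q - s))) * (\<kappa> / (Q - s)\<^sup>2)
      = 1 / (Q - s) - 1 / (Q + \<kappa> / (c - m) - s)" if "s < c" for s
  proof -
    define p where "p = (c - m) * (Q - s) + \<kappa>"
    have "c - (m - \<kappa> / (Q - s)) = p / (Q - s)" "Q + \<kappa> / (c - m) - s = p / (c - m)"
      using that assms by (auto simp: p_def field_simps)
    moreover have "p > 0" using that assms by (auto simp: p_def intro!: add_pos_pos)
    then have "1 / (Q - s) - (c - m) / p = \<kappa> / (p * (Q - s))"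
      using that assms by (simp add: divide_simps) (simp add: p_def)
    ultimately show ?thesis using that assms by (simp add: power2_eq_square)
  qed
  have "(\<integral>\<^sup>+u. ennreal (indicator B (Q + \<kappa> / (u - m)) * (1 / (c - u))
            * indicator {m - \<kappa> / (Q - c)<..<m} u) \<partial>lborel)
    = (\<integral>\<^sup>+s. ennreal (indicator B (Q + \<kappa> / (m - \<kappa> / (Q - s) - m))
            * (1 / (c - (m - \<kappa> / (Q - s)))) * (\<kappa> / (Q - s)\<^sup>2) * indicator {..<c} s) \<partial>lborel)"
    using assms by (intro nn_integral_moebius_reflected) auto
  also have "\<dots> = (\<integral>\<^sup>+s. ennreal (indicator B s * (1 / (Q - s) - 1 / (Q + \<kappa> / (c - m) - s))
            * indicator {..<c} s) \<partial>lborel)"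
  proof (intro nn_integral_cong arg_cong[where f = ennreal])
    fix s show "indicator B (Q + \<kappa> / (m - \<kappa> / (Q - s) - m))
            * (1 / (c - (m - \<kappa> / (Q - s)))) * (\<kappa> / (Q - s)\<^sup>2) * indicator {..<c} s
       = indicator B s * (1 / (Q - s) - 1 / (Q + \<kappa> / (c - m) - s)) * (indicator {..<c} s :: real)"
    proof (cases "s < c")
      case True
      then show ?thesis using assms unfolding mult.assoc[of _ "1 / _"] cross[OF True] by simp
    qed simp
  qed
  finally show ?thesis .
qed

text \<open>
  The affine branch fixes \<open>\<infinity>\<close>, so only the pole at the image of \<open>c\<close> remains.
\<close>

lemma branch_density_translation:
  fixes a c :: real and B :: "real set"
  assumes [measurable]: "B \<in> sets borel"
  shows "(\<integral>\<^sup>+u. ennreal (indicator B (u + a) * (1 / (c - u)) * indicator {..<c - a} u) \<partial>lborel)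
    = (\<integral>\<^sup>+s. ennreal (indicator B s * (1 / (c + a - s)) * indicator {..<c} s) \<partial>lborel)"
  by (subst nn_integral_real_affine[where c = 1 and t = "- a"])
    (auto intro!: nn_integral_cong simp: indicator_def algebra_simps)

section \<open>The seven branches in the coordinate u\<close>

text \<open>
  The interior of the sector \<open>\<Sigma>\<^sub>i\<close>, for \<open>1 \<le> i \<le> 7\<close>.  On it the branch has neither a pole nor a
  competing sector.  The lower end of \<open>\<Sigma>\<^sub>7\<close> is \<open>\<infinity>\<close>, which is not among the cuts.
\<close>

definition oct_arc :: "nat \<Rightarrow> real set"
  where "oct_arc i = (if i = 7 then {..<oct_cut 6} else {oct_cut i<..<oct_cut (i - 1)})"

definition oct_branch :: "nat \<Rightarrow> real \<Rightarrow> real"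
  where "oct_branch i u = the (rp1_act (oct_gamma ** oct_nu i) (Some u))"

text \<open>
  Entry \<open>i\<close> is \<open>\<integral> dy / (y - s)\<^sup>2\<close> over the tile \<open>T\<^sub>i \<Sigma>\<^sub>0\<close>, so its poles are the finite ends of that tile.
  The order of the tiles along the line is \<open>1, 6, 3, 4, 5, 2, 7\<close>, with the common ends
  \<open>c < 2 c - 1 < c + 2 < 2 c < 3 c - 2 < 2 c + 1 < 3 c\<close>.  Entry \<open>0\<close> is a dummy.
\<close>

definition oct_weight :: "nat \<Rightarrow> real \<Rightarrow> real"
  where "oct_weight i s = (let c = 1 + sqrt 2 in
    [0,
     1 / (c - s) - 1 / (2 * c - 1 - s),
     1 / (2 * c + 1 - s) - 1 / (3 * c - s),
     1 / (c + 2 - s) - 1 / (2 * c - s),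
     1 / (2 * c - s) - 1 / (3 * c - 2 - s),
     1 / (3 * c - 2 - s) - 1 / (2 * c + 1 - s),
     1 / (2 * c - 1 - s) - 1 / (c + 2 - s),
     1 / (3 * c - s)] ! i)"

lemma index_cases:
  assumes "i \<in> {1..7::nat}"
  obtains "i = 1" | "i = 2" | "i = 3" | "i = 4" | "i = 5" | "i = 6" | "i = 7"
proof -
  have "i = 1 \<or> i = 2 \<or> i = 3 \<or> i = 4 \<or> i = 5 \<or> i = 6 \<or> i = 7" using assms by auto
  with that show ?thesis by blast
qed

lemma atLeastAtMost_1_7: "{1..7::nat} = {1, 2, 3, 4, 5, 6, 7}" by auto

section \<open>The sectors on the projective line\<close>

lemma oct_cut_antimono: "i \<le> j \<Longrightarrow> j < 7 \<Longrightarrow> oct_cut j \<le> oct_cut i"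
  using cut_less[of i j] by (cases "i = j") auto

text \<open>
  A point lies in some sector, and that sector is contained in a closed interval between two
  neighbouring cuts.  Strict inequalities leave only one such interval.
\<close>

lemma Some_in_oct_sector:
  assumes "i \<in> {1..7}" "u \<in> oct_arc i"
  shows "Some u \<in> oct_sector i"
proof -
  obtain j where j: "j < 8" "Some u \<in> oct_sector j" using sector_cover by blast
  then have box: "Some u \<in> oct_box j" using sector_box by blast
  have "j = i"
  proof (rule ccontr)
    assume "j \<noteq> i"
    then consider "j < i" | "i < j" by linarith
    then show False
    proof cases
      case 1
      then have "oct_cut j \<le> u" using box_ge[OF _ box] assms(1) by auto
      moreover have "u < oct_cut (i - 1)"
        using assms 1 by (auto simp: oct_arc_def split: if_splits)
      moreover have "oct_cut (i - 1) \<le> oct_cut j"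
        using 1 assms(1) by (intro oct_cut_antimono) auto
      ultimately show False by linarith
    next
      case 2
      then have "u \<le> oct_cut (j - 1)" using box_le[OF j(1) _ box] by auto
      moreover have "oct_cut i < u"
        using assms 2 j by (auto simp: oct_arc_def split: if_splits)
      moreover have "oct_cut (j - 1) \<le> oct_cut i"
        using 2 j by (intro oct_cut_antimono) auto
      ultimately show False by linarith
    qed
  qed
  with j show ?thesis by simp
qed

lemma oct_arcs_disjoint:
  assumes "i \<in> {1..7}" "j \<in> {1..7}" "u \<in> oct_arc i" "u \<in> oct_arc j"
  shows "i = j"
proof -
  have False if "i < j" "i \<in> {1..7}" "j \<in> {1..7}" "u \<in> oct_arc i" "u \<in> oct_arc j" for i j
  proof -
    have "oct_cut i < u" "u < oct_cut (j - 1)"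
      using that by (auto simp: oct_arc_def split: if_splits)
    moreover have "oct_cut (j - 1) \<le> oct_cut i"
      using that by (intro oct_cut_antimono) auto
    ultimately show False by linarith
  qed
  with assms show ?thesis by (metis linorder_neqE_nat)
qed

lemma oct_arcs_cover:
  assumes "u \<le> 1 + sqrt 2" "u \<notin> oct_cut ` {..6}"
  shows "\<exists>i\<in>{1..7}. u \<in> oct_arc i"
proof -
  obtain i where i: "i < 8" "Some u \<in> oct_box i" using sector_cover sector_box by blast
  have ge: "i < 7 \<Longrightarrow> oct_cut i < u" using box_ge[OF _ i(2)] assms(2) by (force simp: le_less)
  have le: "0 < i \<Longrightarrow> u < oct_cut (i - 1)" using box_le[OF i(1) _ i(2)] assms(2) i(1) by (force simp: le_less)
  have "i \<noteq> 0"
  proof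
    assume "i = 0"
    with ge assms(1) show False by (simp add: oct_cut_def)
  qed
  then show ?thesis using ge le i(1) by (intro bexI[of _ i]) (auto simp: oct_arc_def)
qed

lemma oct_arc_subset: "i \<in> {1..7} \<Longrightarrow> oct_arc i \<subseteq> {..<1 + sqrt 2}"
proof
  fix u assume i: "i \<in> {1..7}" and "u \<in> oct_arc i"
  then have "u < oct_cut (i - 1)" by (auto simp: oct_arc_def split: if_splits)
  also have "oct_cut (i - 1) \<le> oct_cut 0" using i by (intro oct_cut_antimono) auto
  finally show "u \<in> {..<1 + sqrt 2}" by (simp add: oct_cut_def)
qed

text \<open>
  The pole of a branch is one of the cuts, so on the open arc the value is a real number.
\<close>

lemma octagon_Farey_on_arc:
  assumes i: "i \<in> {1..7}" and u: "u \<in> oct_arc i"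
  shows "octagon_Farey (Some u) = Some (oct_branch i u)"
proof -
  have "Some u \<in> oct_closed_sector i"
    using Some_in_oct_sector[OF assms] sector_subset_closed by blast
  then have "octagon_Farey (Some u) = rp1_act (oct_gamma ** oct_nu i) (Some u)"
    using i by (intro octagon_Farey_eq) auto
  moreover have "rp1_act (oct_gamma ** oct_nu i) (Some u) \<noteq> None"
    using i
    by (cases rule: index_cases)
      (use u in \<open>auto simp: oct_arc_def oct_cut_def oct_nu_def oct_gamma_def mult_scale act_scale
         mat2_mult rp1_act_def\<close>, simp_all add: field_simps)
  ultimately show ?thesis by (simp add: oct_branch_def)
qed

lemma oct_Sigma_eq: "oct_Sigma = Some ` {..1 + sqrt 2}"
proof (intro set_eqI iffI)
  fix p assume "p \<in> oct_Sigma"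
  then obtain i where i: "i \<in> {1..7}" "p \<in> oct_sector i" by (auto simp: oct_Sigma_def)
  then obtain t where t: "p = rp1_of_angle t" "real i * pi / 8 \<le> t" "t < real (i + 1) * pi / 8"
    by (auto simp: oct_sector_def)
  have "pi \<le> real i * pi" "real (i + 1) * pi \<le> 8 * pi" using i by (auto intro!: mult_right_mono)
  with t have "pi / 8 \<le> t" "t < pi" by linarith+
  moreover have "0 < pi / 8" by simp
  ultimately have "0 < sin t" "cot t \<le> cot (pi / 8)"
    by (intro sin_gt_zero cot_mono; linarith)+
  then show "p \<in> Some ` {..1 + sqrt 2}" by (auto simp: t rp1_of_angle_def cot_pi_8)
next
  fix p assume "p \<in> Some ` {..1 + sqrt 2}"
  then obtain u where u: "p = Some u" "u \<le> 1 + sqrt 2" by auto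
  show "p \<in> oct_Sigma"
  proof (cases "u = 1 + sqrt 2")
    case True
    have "p = rp1_of_angle (pi / 8)"
      using sin_gt_zero[of "pi / 8"] by (simp add: u True rp1_of_angle_def cot_pi_8)
    then have "p \<in> oct_sector 1" by (auto simp: oct_sector_def)
    then show ?thesis by (force simp: oct_Sigma_def)
  next
    case False
    obtain i where i: "i < 8" "p \<in> oct_sector i" using sector_cover by blast
    have "i \<noteq> 0"
    proof
      assume "i = 0"
      then have "Some u \<in> oct_box 0" using i sector_box[of 0] u by auto
      then show False using box_ge[of 0 u] u False by (simp add: oct_cut_def)
    qed
    with i show ?thesis by (auto simp: oct_Sigma_def)
  qed
qed

section \<open>The measure in the coordinate u\<close>

lemma space_rp1_borel: "space rp1_borel = UNIV"
  by (simp add: rp1_borel_def)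

lemma sets_rp1_borel_image_Some:
  assumes "A \<in> sets borel" shows "Some ` A \<in> sets rp1_borel"
proof -
  have "A \<in> sigma_sets UNIV {S :: real set. open S}"
    using assms by (simp add: borel_def)
  then show ?thesis
  proof (induction rule: sigma_sets.induct)
    case (Basic S)
    then have "openin rp1_topology (Some ` S)" by simp
    then show ?case by (auto simp: rp1_borel_def)
  next
    case (Compl S)
    have "openin rp1_topology (Some ` UNIV)" by simp
    then have "Some ` UNIV \<in> sets rp1_borel" unfolding rp1_borel_def by auto
    moreover have "Some ` (UNIV - S) = Some ` UNIV - Some ` S" by auto
    ultimately show ?case using Compl by auto
  qed (auto simp: image_UN)
qed

text \<open>
  Both directions are needed to move a measurable set of the projective line to the real line and back:
  \<open>Some\<close> is measurable, and it is an open map, so it also carries Borel sets to Borel sets.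
\<close>

lemma sets_farey_measure:
  "sets farey_measure = (\<lambda>A. Some ` A) ` {A \<in> sets borel. A \<subseteq> {..1 + sqrt 2}}"
proof -
  have "oct_Sigma \<inter> space rp1_borel \<in> sets rp1_borel"
    using sets_rp1_borel_image_Some[of "{..1 + sqrt 2}"] by (simp add: oct_Sigma_eq space_rp1_borel)
  then have iff: "D \<in> sets farey_measure \<longleftrightarrow> D \<subseteq> oct_Sigma \<and> D \<in> sets rp1_borel" for D
    by (simp add: farey_measure_def sets_restrict_space_iff)
  show ?thesis
  proof (intro set_eqI iffI)
    fix D assume "D \<in> sets farey_measure"
    then have D: "D \<subseteq> Some ` {..1 + sqrt 2}" "D \<in> sets rp1_borel" by (simp_all add: iff oct_Sigma_eq)
    then have "Some -` D \<in> sets borel"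
      using measurable_sets[OF measurable_Some_rp1_borel D(2)] by simp
    moreover have "D = Some ` (Some -` D)" "Some -` D \<subseteq> {..1 + sqrt 2}" using D by auto
    ultimately show "D \<in> (\<lambda>A. Some ` A) ` {A \<in> sets borel. A \<subseteq> {..1 + sqrt 2}}" by blast
  qed (auto simp: iff oct_Sigma_eq sets_rp1_borel_image_Some)
qed

text \<open>
  At the endpoint \<open>u = 1 + sqrt 2\<close> the formula for the density has the value \<open>1 / 0 = 0\<close>; being a single
  point, it does not matter for the integral.
\<close>

lemma emeasure_farey_measure:
  assumes [measurable]: "A \<in> sets borel" and A: "A \<subseteq> {..1 + sqrt 2}"
  shows "emeasure farey_measure (Some ` A)
    = (\<integral>\<^sup>+u. ennreal (indicator A u * (1 / (1 + sqrt 2 - u))) \<partial>lborel)"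
proof -
  define S where "S = {..1 + sqrt 2}"
  have S: "{u. Some u \<in> oct_Sigma} = S" by (auto simp: oct_Sigma_eq S_def)
  have [measurable]: "S \<in> sets borel" by (simp add: S_def)
  have meas: "Some \<in> density (restrict_space lborel S) (\<lambda>u. ennreal (1 / (1 + sqrt 2 - u)))
      \<rightarrow>\<^sub>M restrict_space rp1_borel oct_Sigma"
    using measurable_Some_rp1_borel
    by (intro measurable_restrict_space2)
      (auto simp: oct_Sigma_eq S_def space_restrict_space cong: measurable_cong_sets
        intro!: measurable_restrict_space1)
  have A': "Some ` A \<in> sets (restrict_space rp1_borel oct_Sigma)"
    using assms sets_farey_measure by (auto simp: farey_measure_def)
  have w: "(\<lambda>u. ennreal (1 / (1 + sqrt 2 - u))) \<in> borel_measurable (restrict_space lborel S)"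
    by (intro measurable_restrict_space1) simp
  have "A \<in> sets (restrict_space lborel S)"
    using A by (auto simp: sets_restrict_space_iff S_def)
  then have "emeasure farey_measure (Some ` A)
    = (\<integral>\<^sup>+u. ennreal (1 / (1 + sqrt 2 - u)) * indicator A u \<partial>restrict_space lborel S)"
    using A A' unfolding farey_measure_def S
    by (subst emeasure_distr[OF meas])
      (use w in \<open>auto simp: emeasure_density space_restrict_space S_def Int_absorb2 inj_vimage_image_eq\<close>)
  also have "\<dots> = (\<integral>\<^sup>+u. ennreal (1 / (1 + sqrt 2 - u)) * indicator A u * indicator S u \<partial>lborel)"
    by (rule nn_integral_restrict_space) simp
  also have "\<dots> = (\<integral>\<^sup>+u. ennreal (indicator A u * (1 / (1 + sqrt 2 - u))) \<partial>lborel)"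
    using A by (intro nn_integral_cong) (auto simp: S_def split: split_indicator)
  finally show ?thesis .
qed

lemma rp1_act_measurable: "(\<lambda>u. the (rp1_act L (Some u))) \<in> borel_measurable borel"
proof -
  have "(\<lambda>u. the (rp1_act L (Some u))) = (\<lambda>u. if L$2$1 * u + L$2$2 = 0 then the None
      else (L$1$1 * u + L$1$2) / (L$2$1 * u + L$2$2))"
    by (simp add: rp1_act_def fun_eq_iff)
  then show ?thesis by simp
qed

lemma oct_branch_measurable [measurable]: "oct_branch i \<in> borel_measurable borel"
  using rp1_act_measurable[of "oct_gamma ** oct_nu i"] by (simp add: oct_branch_def[abs_def])

lemma oct_arc_measurable [measurable]: "oct_arc i \<in> sets borel"
  by (simp add: oct_arc_def)

section \<open>Invariance\<close>

definition oct_preimage :: "real set \<Rightarrow> real set"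
  where "oct_preimage B = {u. u \<le> 1 + sqrt 2 \<and> octagon_Farey (Some u) \<in> Some ` B}"

lemma oct_preimage_on_arc:
  assumes "i \<in> {1..7}" "u \<in> oct_arc i"
  shows "u \<in> oct_preimage B \<longleftrightarrow> oct_branch i u \<in> B"
  using oct_arc_subset[OF assms(1)] assms by (auto simp: oct_preimage_def octagon_Farey_on_arc)

text \<open>
  Outside the finite set of cuts the preimage is described by the branches.  On the cuts, where the value
  of the map may be \<open>\<infinity>\<close>, membership can be anything without affecting measurability.
\<close>

lemma oct_preimage_borel:
  assumes [measurable]: "B \<in> sets borel"
  shows "oct_preimage B \<in> sets borel"
proof -
  define P where "P = oct_preimage B"
  define C where "C = oct_cut ` {..6}"
  define U where "U = (\<Union>i\<in>{1..7}. {u \<in> oct_arc i. oct_branch i u \<in> B})"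
  have "P = (P \<inter> C) \<union> U - (C - P)"
  proof (intro set_eqI iffI)
    fix u assume u: "u \<in> P"
    then have le: "u \<le> 1 + sqrt 2" by (simp add: P_def oct_preimage_def)
    show "u \<in> (P \<inter> C) \<union> U - (C - P)"
    proof (cases "u \<in> C")
      case False
      then obtain i where "i \<in> {1..7}" "u \<in> oct_arc i"
        using oct_arcs_cover[OF le] unfolding C_def by (elim meta_impE bexE)
      with u show ?thesis unfolding U_def P_def using oct_preimage_on_arc by blast
    qed (use u in simp)
  next
    fix u assume "u \<in> (P \<inter> C) \<union> U - (C - P)"
    then show "u \<in> P" unfolding U_def P_def using oct_preimage_on_arc by blast
  qed
  moreover have "finite (P \<inter> C)" "finite (C - P)" by (simp_all add: C_def)
  then have "P \<inter> C \<in> sets borel" "C - P \<in> sets borel"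
    by (blast intro: borel_closed finite_imp_closed)+
  moreover have "U \<in> sets borel" unfolding U_def by measurable
  ultimately have "P \<in> sets borel" by (metis sets.Diff sets.Un)
  then show ?thesis by (simp add: P_def)
qed

text \<open>
  Every point of \<open>\<Sigma>\<close> other than a cut lies in exactly one open arc, so at most one summand is nonzero.
\<close>

lemma indicator_oct_preimage:
  assumes cut: "u \<notin> oct_cut ` {..6}"
  shows "indicator (oct_preimage B) u * w
    = (\<Sum>i\<in>{1..7}. indicator B (oct_branch i u) * w * indicator (oct_arc i) u :: real)"
proof (cases "u \<le> 1 + sqrt 2")
  case True
  obtain j where j: "j \<in> {1..7}" "u \<in> oct_arc j" by (rule bexE[OF oct_arcs_cover[OF True cut]])
  have "(\<Sum>i\<in>{1..7}. indicator B (oct_branch i u) * w * indicator (oct_arc i) u)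
    = (\<Sum>i\<in>{1..7}. if i = j then indicator B (oct_branch j u) * w else 0)"
  proof (intro sum.cong refl)
    fix i :: nat assume i: "i \<in> {1..7}"
    show "indicator B (oct_branch i u) * w * indicator (oct_arc i) u
      = (if i = j then indicator B (oct_branch j u) * w else 0)"
    proof (cases "i = j")
      case False
      then have "u \<notin> oct_arc i" using oct_arcs_disjoint[OF i j(1) _ j(2)] by blast
      with False show ?thesis by simp
    qed (use j in simp)
  qed
  also have "\<dots> = indicator B (oct_branch j u) * w"
    using j(1) by simp
  also have "indicator B (oct_branch j u) = indicator (oct_preimage B) u"
    using oct_preimage_on_arc[OF j, of B] by (simp add: indicator_def)
  finally show ?thesis by (rule sym)
next
  case False
  have "u \<notin> oct_arc i" if "i \<in> {1..7}" for i
    using oct_arc_subset[OF that] False by auto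
  with False show ?thesis by (simp add: oct_preimage_def)
qed

theorem proposition4p5:
  fixes D :: "rp1 set"
  assumes "D \<in> sets farey_measure"
  shows "octagon_Farey -` D \<inter> oct_Sigma \<in> sets farey_measure
    \<and> emeasure farey_measure (octagon_Farey -` D \<inter> oct_Sigma) = emeasure farey_measure D"
proof -
  let ?c = "1 + sqrt 2"
  obtain B where B [measurable]: "B \<in> sets borel" and Bc: "B \<subseteq> {..?c}" and D: "D = Some ` B"
    using assms by (auto simp: sets_farey_measure)
  have P: "oct_preimage B \<in> sets borel" "oct_preimage B \<subseteq> {..?c}"
    using oct_preimage_borel[OF B] by (auto simp: oct_preimage_def)
  have pre: "octagon_Farey -` D \<inter> oct_Sigma = Some ` oct_preimage B"
    by (auto simp: oct_preimage_def oct_Sigma_eq D)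
  have s2: "1 < sqrt 2" "sqrt 2 \<le> 2" using sqrt2_bounds by simp_all
  have weight_nonneg: "0 \<le> oct_weight i s" if i: "i \<in> {1..7}" and s: "s < ?c" for i s
  proof -
    have "s < 1 + sqrt 2" "s < 1 + 2 * sqrt 2" "s < 3 + sqrt 2" "s < 2 + 2 * sqrt 2"
      "s < 1 + 3 * sqrt 2" "s < 3 + 2 * sqrt 2" "s < 3 + 3 * sqrt 2"
      using s s2 by linarith+
    with i s2(2) show ?thesis
      by (elim index_cases) (simp_all add: oct_weight_def Let_def frac_le)
  qed
  have weight_measurable: "oct_weight i \<in> borel_measurable borel" if i: "i \<in> {1..7}" for i
  proof -
    have "(\<lambda>s. oct_weight i s) \<in> borel_measurable borel"
      using i unfolding oct_weight_def Let_def by (elim index_cases) simp_all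
    then show ?thesis by simp
  qed
  note [measurable] = weight_measurable
  \<comment> \<open>Each tile begins where another one ends, so everything cancels except the pole at the left end
    \<open>1 + sqrt 2\<close> of the first tile.\<close>
  have weight_sum: "(\<Sum>i\<in>{1..7}. oct_weight i s) = 1 / (?c - s)" for s
    unfolding atLeastAtMost_1_7 by (simp add: oct_weight_def Let_def)

  \<comment> \<open>The branches in the normal form of the push-forward lemmas; the scalar \<open>1 / sqrt 2\<close> in \<open>\<nu>\<^sub>i\<close> does
    not affect the action.\<close>
  have branch_values:
    "u \<noteq> 1 \<Longrightarrow> oct_branch 1 u = 1 + 2 * sqrt 2 - 2 / (u - 1)"
    "u \<noteq> 1 \<Longrightarrow> oct_branch 2 u = 3 + 2 * sqrt 2 + 2 / (u - 1)"
    "u \<noteq> 0 \<Longrightarrow> oct_branch 3 u = 2 + 2 * sqrt 2 - 1 / (u - 0)"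
    "u \<noteq> 0 \<Longrightarrow> oct_branch 4 u = 2 + 2 * sqrt 2 + 1 / (u - 0)"
    "u \<noteq> -1 \<Longrightarrow> oct_branch 5 u = 3 + 2 * sqrt 2 - 2 / (u - - 1)"
    "u \<noteq> -1 \<Longrightarrow> oct_branch 6 u = 1 + 2 * sqrt 2 + 2 / (u - - 1)"
    "oct_branch 7 u = u + (2 + 2 * sqrt 2)" for u
    by (simp_all add: oct_branch_def oct_nu_def oct_gamma_def mult_scale act_scale mat2_mult rp1_act_def)
      (simp_all add: field_simps)
  have denominators: "2 / sqrt 2 = sqrt 2" "1 / (1 + sqrt 2) = sqrt 2 - 1" "2 / (2 + sqrt 2) = 2 - sqrt 2"
    using inv_c by (simp_all add: field_simps add_pos_pos add_nonneg_eq_0_iff)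
  note defs = oct_arc_def oct_cut_def oct_weight_def Let_def denominators

  \<comment> \<open>Each branch is an instance of a push-forward lemma.  What has to be checked is that the interval in
    the instance is the sector and that the poles are the ends of the tile; this is arithmetic in
    \<open>sqrt 2\<close>.\<close>
  have branch_integral:
    "(\<integral>\<^sup>+u. ennreal (indicator B (oct_branch i u) * (1 / (?c - u)) * indicator (oct_arc i) u) \<partial>lborel)
      = (\<integral>\<^sup>+s. ennreal (indicator B s * oct_weight i s * indicator {..<?c} s) \<partial>lborel)"
    (is "?lhs i = ?rhs i") if i: "i \<in> {1..7}" for i
  proof -
    \<comment> \<open>\<open>p\<close> and \<open>q\<close> let each case supply simplified forms of the two denominators\<close>
    have increasing: ?thesis
      if "oct_arc i = {m<..<m + \<kappa> / p}" "p = Q - ?c" "q = ?c - m" "0 < \<kappa>" "?c < Q" "m + \<kappa> / p \<le> ?c"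
        "\<And>u. u \<noteq> m \<Longrightarrow> oct_branch i u = Q - \<kappa> / (u - m)"
        "\<And>s. oct_weight i s = 1 / (Q - \<kappa> / q - s) - 1 / (Q - s)"
      for m Q \<kappa> p q
    proof -
      have "(\<integral>\<^sup>+u. ennreal (indicator B (oct_branch i u) * (1 / (?c - u)) * indicator (oct_arc i) u) \<partial>lborel)
        = (\<integral>\<^sup>+u. ennreal (indicator B (Q - \<kappa> / (u - m)) * (1 / (?c - u)) * indicator (oct_arc i) u) \<partial>lborel)"
        using that(1,7) by (intro nn_integral_cong) (simp split: split_indicator)
      then show ?thesis
        using branch_density_increasing[OF B, of \<kappa> ?c Q m] that by simp
    qed
    have decreasing: ?thesis
      if "oct_arc i = {m - \<kappa> / p<..<m}" "p = Q - ?c" "q = ?c - m" "0 < \<kappa>" "?c < Q" "m < ?c"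
        "\<And>u. u \<noteq> m \<Longrightarrow> oct_branch i u = Q + \<kappa> / (u - m)"
        "\<And>s. oct_weight i s = 1 / (Q - s) - 1 / (Q + \<kappa> / q - s)"
      for m Q \<kappa> p q
    proof -
      have "(\<integral>\<^sup>+u. ennreal (indicator B (oct_branch i u) * (1 / (?c - u)) * indicator (oct_arc i) u) \<partial>lborel)
        = (\<integral>\<^sup>+u. ennreal (indicator B (Q + \<kappa> / (u - m)) * (1 / (?c - u)) * indicator (oct_arc i) u) \<partial>lborel)"
        using that(1,7) by (intro nn_integral_cong) (simp split: split_indicator)
      then show ?thesis
        using branch_density_decreasing[OF B, of \<kappa> ?c Q m] that by simp
    qed
    show ?thesis
      using i
    proof (cases rule: index_cases)
      case 1
      show ?thesis
        by (rule increasing[of 1 2 "sqrt 2" "1 + 2 * sqrt 2" "sqrt 2"])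
          (use s2 in \<open>simp_all add: 1 defs branch_values[unfolded One_nat_def]\<close>)
    next
      case 2
      show ?thesis
        by (rule decreasing[of 1 2 "2 + sqrt 2" "3 + 2 * sqrt 2" "sqrt 2"])
          (use s2 in \<open>simp_all add: 2 defs branch_values add_pos_pos\<close>)
    next
      case 3
      show ?thesis
        by (rule increasing[of 0 1 "1 + sqrt 2" "2 + 2 * sqrt 2" "1 + sqrt 2"])
          (use s2 in \<open>simp_all add: 3 defs branch_values add_pos_pos\<close>)
    next
      case 4
      show ?thesis
        by (rule decreasing[of 0 1 "1 + sqrt 2" "2 + 2 * sqrt 2" "1 + sqrt 2"])
          (use s2 in \<open>simp_all add: 4 defs branch_values add_pos_pos\<close>)
    next
      case 5
      show ?thesis
        by (rule increasing[of "-1" 2 "2 + sqrt 2" "3 + 2 * sqrt 2" "2 + sqrt 2"])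
          (use s2 in \<open>simp_all add: 5 defs branch_values add_pos_pos\<close>)
    next
      case 6
      show ?thesis
        by (rule decreasing[of "-1" 2 "sqrt 2" "1 + 2 * sqrt 2" "2 + sqrt 2"])
          (use s2 in \<open>simp_all add: 6 defs branch_values add_pos_pos\<close>)
    next
      case 7
      have "oct_arc i = {..<?c - (2 + 2 * sqrt 2)}" "\<And>s. oct_weight i s = 1 / (?c + (2 + 2 * sqrt 2) - s)"
        "\<And>u. oct_branch i u = u + (2 + 2 * sqrt 2)"
        by (simp_all add: 7 defs branch_values)
      then show ?thesis
        using branch_density_translation[OF B, of "2 + 2 * sqrt 2" ?c] by simp
    qed
  qed

  have "emeasure farey_measure (octagon_Farey -` D \<inter> oct_Sigma)
    = (\<integral>\<^sup>+u. ennreal (indicator (oct_preimage B) u * (1 / (?c - u))) \<partial>lborel)"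
    by (simp only: pre emeasure_farey_measure[OF P])
  also have "\<dots> = (\<integral>\<^sup>+u. (\<Sum>i\<in>{1..7}. ennreal (indicator B (oct_branch i u) * (1 / (?c - u))
      * indicator (oct_arc i) u)) \<partial>lborel)"
  proof (rule nn_integral_cong_AE)
    have "AE u in lborel. u \<notin> oct_cut ` {..6}"
      by (intro AE_not_in finite_imp_null_set_lborel) simp
    then show "AE u in lborel. ennreal (indicator (oct_preimage B) u * (1 / (?c - u)))
      = (\<Sum>i\<in>{1..7}. ennreal (indicator B (oct_branch i u) * (1 / (?c - u)) * indicator (oct_arc i) u))"
    proof eventually_elim
      case (elim u)
      have "(\<Sum>i\<in>{1..7}. ennreal (indicator B (oct_branch i u) * (1 / (?c - u)) * indicator (oct_arc i) u))
        = ennreal (\<Sum>i\<in>{1..7}. indicator B (oct_branch i u) * (1 / (?c - u)) * indicator (oct_arc i) u)"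
        by (intro sum_ennreal) (auto dest: subsetD[OF oct_arc_subset, rotated] split: split_indicator)
      also have "\<dots> = ennreal (indicator (oct_preimage B) u * (1 / (?c - u)))"
        by (rule arg_cong[where f = ennreal, OF indicator_oct_preimage[OF elim, symmetric]])
      finally show ?case by (rule sym)
    qed
  qed
  also have "\<dots> = (\<Sum>i\<in>{1..7}. ?lhs i)"
    by (rule nn_integral_sum) measurable
  also have "\<dots> = (\<Sum>i\<in>{1..7}. ?rhs i)"
    by (intro sum.cong refl branch_integral)
  also have "\<dots> = (\<integral>\<^sup>+s. (\<Sum>i\<in>{1..7}. ennreal (indicator B s * oct_weight i s * indicator {..<?c} s)) \<partial>lborel)"
    by (rule nn_integral_sum[symmetric]) measurable
  also have "\<dots> = (\<integral>\<^sup>+s. ennreal (indicator B s * (1 / (?c - s))) \<partial>lborel)"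
  proof (rule nn_integral_cong)
    fix s
    have "(\<Sum>i\<in>{1..7}. ennreal (indicator B s * oct_weight i s * indicator {..<?c} s))
      = ennreal (\<Sum>i\<in>{1..7}. indicator B s * oct_weight i s * indicator {..<?c} s)"
      by (intro sum_ennreal) (auto simp: weight_nonneg split: split_indicator)
    also have "(\<Sum>i\<in>{1..7}. indicator B s * oct_weight i s * indicator {..<?c} s)
      = indicator B s * (1 / (?c - s)) * indicator {..<?c} s"
      by (simp only: sum_distrib_left[symmetric] sum_distrib_right[symmetric] weight_sum)
    \<comment> \<open>At \<open>s = 1 + sqrt 2\<close> both sides are \<open>0\<close> because division by \<open>0\<close> gives \<open>0\<close>.\<close>
    also have "\<dots> = indicator B s * (1 / (?c - s))"
      using Bc by (auto simp: indicator_def)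
    finally show "(\<Sum>i\<in>{1..7}. ennreal (indicator B s * oct_weight i s * indicator {..<?c} s))
      = ennreal (indicator B s * (1 / (?c - s)))" .
  qed
  also have "\<dots> = emeasure farey_measure D"
    by (simp only: D emeasure_farey_measure[OF B Bc])
  finally show ?thesis
    using P by (simp add: pre sets_farey_measure)
qed

end
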